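(* Let $d\ge 2$ be an integer and let $N=(d+1)^2$. There exist configurations $\mathbf{p}=(\mathbf{p}_1,\ldots,\mathbf{p}_N)$ and $\mathbf{q}=(\mathbf{q}_1,\ldots,\mathbf{q}_N)$ of $N$ ordered points in $\mathbb{E}^d$ such that $\mathbf{q}$ is an expansion of $\mathbf{p}$, but for every integer $f$ with $d\le f<2d$ there is no continuous expansion from $\mathbf{p}$ to $\mathbf{q}$ in $\mathbb{E}^f$.
   Context: $\mathbb{E}^n$ denotes $n$-dimensional Euclidean space (points identified with vectors in $\mathbb{R}^n$) with its standard inner product and norm $|\cdot|$. For $f\ge d$, $\iota:\mathbb{E}^d\to\mathbb{E}^f$ is the standard inclusion $\iota(u_1,\ldots,u_d)=(u_1,\ldots,u_d,0,\ldots,0)$ (the identity if $f=d$). Let $\mathbf{p}=(\mathbf{p}_1,\ldots,\mathbf{p}_N)$ and $\mathbf{q}=(\mathbf{q}_1,\ldots,\mathbf{q}_N)$ be configurations of $N$ ordered points in $\mathbb{E}^d$. We say $\mathbf{q}$ is an expansion of $\mathbf{p}$ if $|\mathbf{p}_i-\mathbf{p}_j|\le|\mathbf{q}_i-\mathbf{q}_j|$ for all $1\le i<j\le N$. We say there is a continuous expansion from $\mathbf{p}$ to $\mathbf{q}$ in $\mathbb{E}^f$ if there exist continuous functions $\mathbf{f}_i:[0,1]\to\mathbb{E}^f$, $i=1,\ldots,N$, such that for all $1\le i<j\le N$ and $0\le t_1<t_2\le 1$: (1) for every index $k\in\{1,\ldots,N\}$, $\mathbf{f}_k(0)=\iota(\mathbf{p}_k)$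 and $\mathbf{f}_k(1)=\iota(\mathbf{q}_k)$; (2) $|\mathbf{f}_i(t_1)-\mathbf{f}_j(t_1)|\le|\mathbf{f}_i(t_2)-\mathbf{f}_j(t_2)|$. *)

theory Defs
  imports "HOL-Analysis.Analysis"
begin

(* Euclidean n-space is the library's topological space Euclidean_space n: its points are the
   sequences nat => real that vanish at all indices >= n, so the coordinates u_1, ..., u_n of a
   point u are u 0, ..., u (n - 1). Its (product) topology is the usual topology of R^n.
   Dimensions are natural numbers rather than types because the target dimension is quantified
   after the configurations have been chosen. *)

definition edist :: "nat \<Rightarrow> (nat \<Rightarrow> real) \<Rightarrow> (nat \<Rightarrow> real) \<Rightarrow> real" where
  "edist n x y = L2_set (\<lambda>k. x k - y k) {..<n}"

(* In this encoding the standard inclusion of Euclidean d-space into f-space (d <= f) pads with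
   zeros that are already there, so it does not depend on f and fixes every point of d-space. *)
definition std_incl :: "nat \<Rightarrow> (nat \<Rightarrow> real) \<Rightarrow> (nat \<Rightarrow> real)" where
  "std_incl d u = (\<lambda>k. if k < d then u k else 0)"

(* Only the values at the indices 1, ..., N of a configuration matter. *)
definition configuration :: "nat \<Rightarrow> nat \<Rightarrow> (nat \<Rightarrow> nat \<Rightarrow> real) \<Rightarrow> bool" where
  "configuration d N p \<longleftrightarrow> (\<forall>i\<in>{1..N}. p i \<in> topspace (Euclidean_space d))"

definition is_expansion ::
    "nat \<Rightarrow> nat \<Rightarrow> (nat \<Rightarrow> nat \<Rightarrow> real) \<Rightarrow> (nat \<Rightarrow> nat \<Rightarrow> real) \<Rightarrow> bool" where
  "is_expansion d N p q \<longleftrightarrow>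
     (\<forall>i j. 1 \<le> i \<and> i < j \<and> j \<le> N \<longrightarrow> edist d (p i) (p j) \<le> edist d (q i) (q j))"

definition continuous_expansion ::
    "nat \<Rightarrow> nat \<Rightarrow> nat \<Rightarrow> (nat \<Rightarrow> nat \<Rightarrow> real) \<Rightarrow> (nat \<Rightarrow> nat \<Rightarrow> real) \<Rightarrow> bool" where
  "continuous_expansion d f N p q \<longleftrightarrow>
     (\<exists>F :: nat \<Rightarrow> real \<Rightarrow> nat \<Rightarrow> real.
        (\<forall>k\<in>{1..N}. continuous_map (top_of_set {0..1}) (Euclidean_space f) (F k)) \<and>
        (\<forall>k\<in>{1..N}. F k 0 = std_incl d (p k) \<and> F k 1 = std_incl d (q k)) \<and>
        (\<forall>i j t1 t2. 1 \<le> i \<and> i < j \<and> j \<le> N \<and> 0 \<le> t1 \<and> t1 < t2 \<and> t2 \<le> 1 \<longrightarrow>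
           edist f (F i t1) (F j t1) \<le> edist f (F i t2) (F j t2)))"

end

theory Submission
  imports Defs
begin

text \<open>
  If at some moment of a continuous expansion every squared distance is the average of its values at
  the two ends, then the configuration at that moment is congruent to the points
  \<open>(p\<^sub>i, q\<^sub>i) / sqrt 2\<close> of Euclidean \<open>2d\<close>-space, so it needs \<open>2d\<close> dimensions as soon as the
  \<open>(p\<^sub>i, q\<^sub>i)\<close> affinely span that space (\<open>averaged_distances_dimension\<close>).
  The example is built so that such a moment is unavoidable.

  It consists of two rigid bodies, a fixed one and a moved one; the moved body of \<open>q\<close> is the image
  of the one of \<open>p\<close> under a glide reflection, which negates \<open>d - 1\<close> coordinates and translates the
  remaining one. A distance whose values at the two ends agree stays constant during an expansion.
  In particular both bodies stay rigid, and therefore a squared distance between a point of one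
  body and a point of the other is, at any time, an affine function of either point up to terms
  that do not depend on the motion. Its deviation from the average of the two end values is thus
  a biaffine function of the two points, and it vanishes on all pairs at constant distance.

  The points lie on parabolas, one for each of the \<open>d - 1\<close> negated coordinates \<open>j\<close>, with integer
  parameters \<open>s\<close> in the fixed and \<open>x\<close> in the moved body. The gain in squared distance is
  \<open>4 (s (s + 1) + x (x - 1) - 2 s x)\<close> \<open>= 4 (x - s) (x - s - 1)\<close> for two points with the same \<open>j\<close>,
  and \<open>4 (s (s + 1) + x (x - 1))\<close> otherwise. Products of consecutive integers are
  nonnegative, so this is an expansion, and they vanish often: the pairs with zero gain determine a
  biaffine function up to one scalar (\<open>biaffine_table_vanishes\<close>). Continuity provides a time at
  which one distance with positive gain is averaged; then the scalar is zero and all distances are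
  averaged (\<open>all_distances_averaged\<close>). Parameters \<open>-2..2\<close> and \<open>-1..2\<close> suffice for this, and as the
  points with parameter zero are shared by all \<open>d - 1\<close> parabolas, there are at most
  \<open>7 d - 5 \<le> (d + 1)\<^sup>2\<close> points. The remaining indices repeat one of them.
\<close>

section \<open>Squared distances and affine dependencies\<close>

definition sqdist :: "nat \<Rightarrow> (nat \<Rightarrow> real) \<Rightarrow> (nat \<Rightarrow> real) \<Rightarrow> real" where
  "sqdist n x y = (\<Sum>k<n. (x k - y k)\<^sup>2)"

lemma edist_eq_sqrt_sqdist: "edist n x y = sqrt (sqdist n x y)"
  by (simp add: edist_def sqdist_def L2_set_def)

lemma sqdist_commute: "sqdist n x y = sqdist n y x"
  by (simp add: sqdist_def power2_commute)

lemma sqdist_self [simp]: "sqdist n x x = 0"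
  by (simp add: sqdist_def)

lemma sqdist_eq_of_supported:
  assumes "d \<le> f" and "\<And>k. d \<le> k \<Longrightarrow> x k = y k"
  shows "sqdist f x y = sqdist d x y"
  unfolding sqdist_def by (rule sum.mono_neutral_right) (use assms in auto)

text \<open>
  The quadratic form of squared distances on weights of sum zero measures the length of the weighted
  sum. So the mutual distances alone, whatever the ambient dimension, decide which affine
  dependencies hold.
\<close>
lemma sum_weighted_sqdist:
  assumes "(\<Sum>i\<in>I. c i) = 0"
  shows "(\<Sum>i\<in>I. \<Sum>j\<in>I. c i * c j * sqdist n (X i) (X j)) =
         - 2 * (\<Sum>k<n. (\<Sum>i\<in>I. c i * X i k)\<^sup>2)"
proof -
  have "(\<Sum>i\<in>I. \<Sum>j\<in>I. c i * c j * sqdist n (X i) (X j)) =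
        (\<Sum>k<n. \<Sum>i\<in>I. \<Sum>j\<in>I. c i * c j * (X i k - X j k)\<^sup>2)"
    unfolding sqdist_def sum_distrib_left
    by (simp only: sum.swap[of _ "{..<n}" I])
  also have "\<dots> = (\<Sum>k<n. - 2 * (\<Sum>i\<in>I. c i * X i k)\<^sup>2)"
  proof (rule sum.cong[OF refl])
    fix k
    have "(\<Sum>i\<in>I. \<Sum>j\<in>I. c i * c j * (X i k - X j k)\<^sup>2) =
      (\<Sum>i\<in>I. \<Sum>j\<in>I. (c i * (X i k)\<^sup>2) * c j) + (\<Sum>i\<in>I. \<Sum>j\<in>I. c i * (c j * (X j k)\<^sup>2))
       - 2 * (\<Sum>i\<in>I. \<Sum>j\<in>I. (c i * X i k) * (c j * X j k))"
      by (simp add: sum.distrib[symmetric] sum_subtractf[symmetric] sum_distrib_left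
          power2_eq_square algebra_simps)
    also have "\<dots> = - 2 * (\<Sum>i\<in>I. c i * X i k)\<^sup>2"
      by (simp add: sum_product[symmetric] assms power2_eq_square)
    finally show "(\<Sum>i\<in>I. \<Sum>j\<in>I. c i * c j * (X i k - X j k)\<^sup>2) = - 2 * (\<Sum>i\<in>I. c i * X i k)\<^sup>2" .
  qed
  finally show ?thesis by (simp add: sum_distrib_left)
qed

lemma dependency_transfers:
  assumes "(\<Sum>i\<in>I. c i) = 0" and "\<And>k. k < d \<Longrightarrow> (\<Sum>i\<in>I. c i * P i k) = 0"
    and "\<And>i j. i \<in> I \<Longrightarrow> j \<in> I \<Longrightarrow> sqdist f (X i) (X j) = sqdist d (P i) (P j)"
    and "k < f"
  shows "(\<Sum>i\<in>I. c i * X i k) = 0"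
proof -
  have "(\<Sum>i\<in>I. \<Sum>j\<in>I. c i * c j * sqdist f (X i) (X j)) =
        (\<Sum>i\<in>I. \<Sum>j\<in>I. c i * c j * sqdist d (P i) (P j))"
    by (intro sum.cong refl) (simp add: assms(3))
  then have "(\<Sum>k<f. (\<Sum>i\<in>I. c i * X i k)\<^sup>2) = 0"
    by (simp add: sum_weighted_sqdist[OF assms(1)] assms(2))
  then show ?thesis
    using assms(4) by (simp add: sum_nonneg_eq_0_iff)
qed

text \<open>In an expanded square, the mixed term and the term of the outer point both cancel.\<close>
lemma dependency_sqdist_const:
  assumes "(\<Sum>i\<in>I. c i) = 0" and "\<And>k. k < n \<Longrightarrow> (\<Sum>i\<in>I. c i * X i k) = 0"
  shows "(\<Sum>i\<in>I. c i * sqdist n (X i) y) = (\<Sum>i\<in>I. c i * sqdist n (X i) z)"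
proof -
  have *: "(\<Sum>i\<in>I. c i * sqdist n (X i) y) = (\<Sum>k<n. \<Sum>i\<in>I. c i * (X i k)\<^sup>2)" for y
  proof -
    have "(\<Sum>i\<in>I. c i * sqdist n (X i) y) = (\<Sum>k<n. \<Sum>i\<in>I. c i * (X i k - y k)\<^sup>2)"
      unfolding sqdist_def sum_distrib_left by (rule sum.swap)
    also have "\<dots> = (\<Sum>k<n. (\<Sum>i\<in>I. c i * (X i k)\<^sup>2) - 2 * y k * (\<Sum>i\<in>I. c i * X i k)
                        + (y k)\<^sup>2 * (\<Sum>i\<in>I. c i))"
      by (intro sum.cong refl)
        (simp add: sum.distrib[symmetric] sum_subtractf[symmetric] sum_distrib_left
          power2_eq_square algebra_simps)
    also have "\<dots> = (\<Sum>k<n. \<Sum>i\<in>I. c i * (X i k)\<^sup>2)"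
      by (intro sum.cong refl) (simp add: assms)
    finally show ?thesis .
  qed
  show ?thesis by (simp only: *)
qed

text \<open>
  The restriction that a rigid body \<open>P\<close>, moved to \<open>X\<close>, puts on the squared distances to an outer point:
  their combination along an affine dependency is independent of the motion and of the outer point,
  since a point of the body itself can take its place.
\<close>
lemma rigid_dependency_sqdist:
  assumes c: "(\<Sum>i\<in>I. c i) = 0" and P: "\<And>k. k < d \<Longrightarrow> (\<Sum>i\<in>I. c i * P i k) = 0"
    and rigid: "\<And>i j. i \<in> I \<Longrightarrow> j \<in> I \<Longrightarrow> sqdist f (X i) (X j) = sqdist d (P i) (P j)"
  shows "(\<Sum>i\<in>I. c i * sqdist f (X i) y) = (\<Sum>i\<in>I. c i * sqdist d (P i) z)"
proof (cases "I = {}")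
  case False
  then obtain w where w: "w \<in> I" by blast
  have X: "\<And>k. k < f \<Longrightarrow> (\<Sum>i\<in>I. c i * X i k) = 0"
    using dependency_transfers[OF c P rigid] by blast
  have "(\<Sum>i\<in>I. c i * sqdist f (X i) y) = (\<Sum>i\<in>I. c i * sqdist f (X i) (X w))"
    by (rule dependency_sqdist_const[OF c X])
  also have "\<dots> = (\<Sum>i\<in>I. c i * sqdist d (P i) (P w))"
    by (intro sum.cong refl) (simp add: rigid w)
  also have "\<dots> = (\<Sum>i\<in>I. c i * sqdist d (P i) z)"
    by (rule dependency_sqdist_const[OF c P])
  finally show ?thesis .
qed simp

text \<open>More unknowns than homogeneous equations; the induction step eliminates the unknown of a pivot.\<close>
lemma ex_null_combination:
  fixes a :: "'i \<Rightarrow> nat \<Rightarrow> real"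
  assumes "finite I" "n < card I"
  shows "\<exists>c. (\<exists>i\<in>I. c i \<noteq> 0) \<and> (\<forall>k<n. (\<Sum>i\<in>I. c i * a i k) = 0)"
  using assms
proof (induction n arbitrary: I a)
  case 0
  then have "I \<noteq> {}" by auto
  then show ?case by (intro exI[of _ "\<lambda>_. 1"]) auto
next
  case (Suc n)
  show ?case
  proof (cases "\<forall>i\<in>I. a i n = 0")
    case True
    obtain c where "\<exists>i\<in>I. c i \<noteq> 0" "\<forall>k<n. (\<Sum>i\<in>I. c i * a i k) = 0"
      using Suc.IH[of I a] Suc.prems by auto
    then show ?thesis
      using True by (intro exI[of _ c]) (auto simp: less_Suc_eq)
  next
    case False
    then obtain w where w: "w \<in> I" "a w n \<noteq> 0" by blast
    define J where "J = I - {w}"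
    define b where "b i k = a i k - a i n / a w n * a w k" for i k
    have J: "finite J" "n < card J" "w \<notin> J" "I = insert w J"
      using Suc.prems w by (auto simp: J_def)
    obtain c where c: "\<exists>i\<in>J. c i \<noteq> 0" "\<forall>k<n. (\<Sum>i\<in>J. c i * b i k) = 0"
      using Suc.IH[of J b] J by auto
    define e where "e = c(w := - (\<Sum>i\<in>J. c i * (a i n / a w n)))"
    have e: "(\<Sum>i\<in>I. e i * a i k) = (\<Sum>i\<in>J. c i * b i k)" for k
    proof -
      have "(\<Sum>i\<in>J. e i * a i k) = (\<Sum>i\<in>J. c i * a i k)"
        using J(3) by (intro sum.cong) (auto simp: e_def)
      then show ?thesis
        using J by (simp add: e_def b_def right_diff_distrib sum_subtractf sum_distrib_right
            mult.assoc)
    qed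
    have "b i n = 0" for i using w by (simp add: b_def)
    then have "\<forall>k<Suc n. (\<Sum>i\<in>I. e i * a i k) = 0"
      using c(2) by (auto simp: e less_Suc_eq)
    moreover have "\<exists>i\<in>I. e i \<noteq> 0"
      using c(1) J by (auto simp: e_def)
    ultimately show ?thesis by blast
  qed
qed

section \<open>Expansions indexed by pairs of end positions\<close>

lemma std_incl_topspace:
  assumes "x \<in> topspace (Euclidean_space d)" shows "std_incl d x = x"
  using assms by (auto simp: std_incl_def Euclidean_space_def)

text \<open>
  Here the points of the configuration are labelled by their pairs of end positions instead of
  numbers. The ends of the motion are prescribed only up to congruence, which is all that the
  argument sees of them.
\<close>
definition expands_along :: "nat \<Rightarrow> nat \<Rightarrow> ((nat \<Rightarrow> real) \<times> (nat \<Rightarrow> real)) set \<Rightarrow>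
    (real \<Rightarrow> (nat \<Rightarrow> real) \<times> (nat \<Rightarrow> real) \<Rightarrow> nat \<Rightarrow> real) \<Rightarrow> bool" where
  "expands_along d f L G \<longleftrightarrow>
     (\<forall>l\<in>L. \<forall>k. continuous_on {0..1} (\<lambda>t. G t l k)) \<and>
     (\<forall>l\<in>L. \<forall>m\<in>L. sqdist f (G 0 l) (G 0 m) = sqdist d (fst l) (fst m)) \<and>
     (\<forall>l\<in>L. \<forall>m\<in>L. sqdist f (G 1 l) (G 1 m) = sqdist d (snd l) (snd m)) \<and>
     (\<forall>l\<in>L. \<forall>m\<in>L. \<forall>s t. 0 \<le> s \<and> s \<le> t \<and> t \<le> 1 \<longrightarrow>
         sqdist f (G s l) (G s m) \<le> sqdist f (G t l) (G t m))"

text \<open>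
  Repeating points leaves the problem unchanged, so any set of at most \<open>N\<close> pairs of end
  positions gives configurations of exactly \<open>N\<close> points.
\<close>
lemma pairs_as_configurations:
  fixes L :: "((nat \<Rightarrow> real) \<times> (nat \<Rightarrow> real)) set"
  assumes L: "finite L" "L \<noteq> {}" "card L \<le> N"
    and dim: "\<And>l. l \<in> L \<Longrightarrow> fst l \<in> topspace (Euclidean_space d) \<and> snd l \<in> topspace (Euclidean_space d)"
    and expanding: "\<And>l m. l \<in> L \<Longrightarrow> m \<in> L \<Longrightarrow>
        sqdist d (fst l) (fst m) \<le> sqdist d (snd l) (snd m)"
  obtains p q where "configuration d N p" "configuration d N q" "is_expansion d N p q"
    "\<And>f. d \<le> f \<Longrightarrow> continuous_expansion d f N p q \<Longrightarrow> \<exists>G. expands_along d f L G"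
proof -
  obtain h where h: "bij_betw h {1..card L} L"
    using ex_bij_betw_nat_finite_1[OF L(1)] by blast
  have pos: "1 \<le> card L" using L by (simp add: Suc_le_eq card_gt_0_iff)
  define e where "e i = (if i \<le> card L then h i else h 1)" for i
  have e_img: "e ` {1..N} = L"
  proof
    have hL: "h i \<in> L" if "1 \<le> i" "i \<le> card L" for i
      using h that by (auto simp: bij_betw_def)
    then show "e ` {1..N} \<subseteq> L" using pos by (auto simp: e_def)
    have "L = e ` {1..card L}" using h by (auto simp: bij_betw_def e_def)
    also have "\<dots> \<subseteq> e ` {1..N}" using L(3) by (intro image_mono) auto
    finally show "L \<subseteq> e ` {1..N}" .
  qed
  then have eL: "e i \<in> L" if "i \<in> {1..N}" for i using that by blast
  \<comment> \<open>One index for each label; the paths of the repetitions are discarded.\<close>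
  define r where "r = inv_into {1..N} e"
  have r: "r l \<in> {1..N}" "e (r l) = l" if "l \<in> L" for l
    using that e_img unfolding r_def by (auto intro: inv_into_into f_inv_into_f simp del: atLeastAtMost_iff)
  let ?p = "\<lambda>i. fst (e i)" and ?q = "\<lambda>i. snd (e i)"
  show ?thesis
  proof
    show "configuration d N ?p" "configuration d N ?q"
      using dim eL by (auto simp: configuration_def)
    show "is_expansion d N ?p ?q"
      using expanding eL by (auto simp: is_expansion_def edist_eq_sqrt_sqdist)
  next
    fix f assume df: "d \<le> f" and "continuous_expansion d f N ?p ?q"
    then obtain F :: "nat \<Rightarrow> real \<Rightarrow> nat \<Rightarrow> real" where
      F: "(\<forall>k\<in>{1..N}. continuous_map (top_of_set {0..1}) (Euclidean_space f) (F k)) \<and>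
        (\<forall>k\<in>{1..N}. F k 0 = std_incl d (?p k) \<and> F k 1 = std_incl d (?q k)) \<and>
        (\<forall>i j s t. 1 \<le> i \<and> i < j \<and> j \<le> N \<and> 0 \<le> s \<and> s < t \<and> t \<le> 1 \<longrightarrow>
           edist f (F i s) (F j s) \<le> edist f (F i t) (F j t))"
      unfolding continuous_expansion_def by blast
    note cont = F[THEN conjunct1, rule_format]
      and ends = F[THEN conjunct2, THEN conjunct1, rule_format]
      and mono = F[THEN conjunct2, THEN conjunct2, rule_format]
    define G where "G t l = F (r l) t" for t l
    have G0: "G 0 l = fst l" and G1: "G 1 l = snd l" if "l \<in> L" for l
      using ends[OF r(1)[OF that]] dim[OF that] r(2)[OF that]
      by (simp_all add: G_def std_incl_topspace)
    have zero: "fst l k = 0" "snd l k = 0" if "l \<in> L" "d \<le> k" for l k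
      using dim[OF that(1)] that(2) by (auto simp: Euclidean_space_def)
    show "\<exists>G. expands_along d f L G"
    proof (intro exI[of _ G] expands_along_def[THEN iffD2] conjI ballI allI impI)
      fix l k assume "l \<in> L"
      then have "continuous_map (top_of_set {0..1}) (Euclidean_space f) (F (r l))"
        using cont r by blast
      then show "continuous_on {0..1} (\<lambda>t. G t l k)"
        unfolding Euclidean_space_def continuous_map_in_subtopology continuous_map_componentwise_UNIV
        by (simp add: G_def)
    next
      fix l m assume "l \<in> L" "m \<in> L"
      then show "sqdist f (G 0 l) (G 0 m) = sqdist d (fst l) (fst m)"
        "sqdist f (G 1 l) (G 1 m) = sqdist d (snd l) (snd m)"
        by (simp_all add: G0 G1 zero sqdist_eq_of_supported[OF df])
    next
      fix l m s t assume lm: "l \<in> L" "m \<in> L" and st: "0 \<le> s \<and> s \<le> t \<and> t \<le> (1::real)"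
      have *: "sqdist f (F i s) (F j s) \<le> sqdist f (F i t) (F j t)"
        if "1 \<le> i" "i < j" "j \<le> N" for i j
        using mono[of i j s t] that st by (cases "s = t") (auto simp: edist_eq_sqrt_sqdist)
      have "1 \<le> r l" "r l \<le> N" "1 \<le> r m" "r m \<le> N"
        using r(1) lm by (auto simp del: One_nat_def)
      then consider "r l = r m" | "1 \<le> r l \<and> r l < r m \<and> r m \<le> N" | "1 \<le> r m \<and> r m < r l \<and> r l \<le> N"
        by linarith
      then show "sqdist f (G s l) (G s m) \<le> sqdist f (G t l) (G t m)"
        unfolding G_def
        using *[of "r l" "r m"] *[of "r m" "r l"]
        by cases (simp_all add: sqdist_commute[of f "F (r l) s"] sqdist_commute[of f "F (r l) t"])
    qed
  qed
qed

section \<open>The point pairs\<close>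

text \<open>
  The fixed points with axis \<open>j\<close> lie on a parabola in the plane of the coordinates \<open>0\<close> and \<open>j\<close>.
\<close>
definition fixed_pt :: "nat \<Rightarrow> int \<Rightarrow> nat \<Rightarrow> real" where
  "fixed_pt j s = (\<lambda>k. if k = 0 then - of_int (s * (s + 1)) else if k = j then 2 * of_int s else 0)"

text \<open>
  The value \<open>e = -1\<close> gives the position before and \<open>e = 1\<close> the position after the motion, which is
  the glide reflection that adds \<open>2\<close> to coordinate \<open>0\<close> and negates the others. The reflection
  accounts for \<open>d - 1\<close> of the \<open>d\<close> extra dimensions, the translation for the last one.
\<close>
definition moved_pt :: "real \<Rightarrow> nat \<Rightarrow> int \<Rightarrow> nat \<Rightarrow> real" where
  "moved_pt e j x = (\<lambda>k. if k = 0 then of_int (x * (x - 1)) + e else if k = j then e * of_int x else 0)"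

definition fixed_pair :: "nat \<Rightarrow> int \<Rightarrow> (nat \<Rightarrow> real) \<times> (nat \<Rightarrow> real)" where
  "fixed_pair j s = (fixed_pt j s, fixed_pt j s)"

definition moved_pair :: "nat \<Rightarrow> int \<Rightarrow> (nat \<Rightarrow> real) \<times> (nat \<Rightarrow> real)" where
  "moved_pair j x = (moved_pt (- 1) j x, moved_pt 1 j x)"

definition point_pairs :: "nat \<Rightarrow> ((nat \<Rightarrow> real) \<times> (nat \<Rightarrow> real)) set" where
  "point_pairs d = (\<lambda>(j, s). fixed_pair j s) ` ({1..<d} \<times> {-2..2}) \<union>
                   (\<lambda>(j, x). moved_pair j x) ` ({1..<d} \<times> {-1..2})"

lemma fixed_pair_0: "fixed_pair j 0 = fixed_pair k 0"
  by (auto simp: fixed_pair_def fixed_pt_def)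

lemma moved_pair_0: "moved_pair j 0 = moved_pair k 0"
  by (auto simp: moved_pair_def moved_pt_def)

text \<open>The point with parameter zero counts once, not once for each axis.\<close>
lemma card_axes_le:
  fixes A :: "int set"
  assumes "1 < d" "finite A" "0 \<in> A" "\<And>j k. g j 0 = g k (0::int)"
  shows "card ((\<lambda>(j, s). g j s) ` ({1..<d} \<times> A)) \<le> 1 + (d - 1) * (card A - 1)"
proof -
  have "(\<lambda>(j, s). g j s) ` ({1..<d} \<times> A) \<subseteq>
        insert (g 1 0) ((\<lambda>(j, s). g j s) ` ({1..<d} \<times> (A - {0})))"
  proof
    fix y assume "y \<in> (\<lambda>(j, s). g j s) ` ({1..<d} \<times> A)"
    then obtain j s where js: "j \<in> {1..<d}" "s \<in> A" "y = g j s" by auto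
    then show "y \<in> insert (g 1 0) ((\<lambda>(j, s). g j s) ` ({1..<d} \<times> (A - {0})))"
      using assms(4)[of j 1] by (cases "s = 0") auto
  qed
  then have "card ((\<lambda>(j, s). g j s) ` ({1..<d} \<times> A)) \<le>
        card (insert (g 1 0) ((\<lambda>(j, s). g j s) ` ({1..<d} \<times> (A - {0}))))"
    by (rule card_mono[rotated]) (use assms in auto)
  also have "\<dots> \<le> 1 + card ((\<lambda>(j, s). g j s) ` ({1..<d} \<times> (A - {0})))"
    using card_insert_le_m1 assms by (simp add: card_insert_if)
  also have "\<dots> \<le> 1 + card ({1..<d} \<times> (A - {0}))"
    using card_image_le[of "{1..<d} \<times> (A - {0})"] assms by auto
  finally show ?thesis using assms by (simp add: card_cartesian_product)
qed

lemma card_point_pairs_le: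
  assumes "2 \<le> d" shows "card (point_pairs d) \<le> (d + 1)\<^sup>2"
proof -
  obtain n where n: "d = n + 2" using assms by (metis add.commute le_Suc_ex)
  have "card (point_pairs d) \<le> (1 + (d - 1) * 4) + (1 + (d - 1) * 3)"
    unfolding point_pairs_def
    using card_axes_le[of d "{-2..2}" fixed_pair, OF _ _ _ fixed_pair_0]
      card_axes_le[of d "{-1..2}" moved_pair, OF _ _ _ moved_pair_0] assms
    by (intro order.trans[OF card_Un_le] add_mono) auto
  \<comment> \<open>The difference of the two sides is \<open>(d - 2) (d - 3)\<close>.\<close>
  also have "\<dots> \<le> (d + 1)\<^sup>2"
    by (cases n) (auto simp: n power2_eq_square algebra_simps)
  finally show ?thesis .
qed

lemma point_pairs_cases:
  assumes "l \<in> point_pairs d"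
  obtains (fixed) j s where "l = fixed_pair j s" "j \<in> {1..<d}" "s \<in> {-2..2}"
  | (moved) j x where "l = moved_pair j x" "j \<in> {1..<d}" "x \<in> {-1..2}"
  using assms unfolding point_pairs_def by auto

lemma fixed_pair_in: "j \<in> {1..<d} \<Longrightarrow> s \<in> {-2..2} \<Longrightarrow> fixed_pair j s \<in> point_pairs d"
  by (auto simp: point_pairs_def)

lemma moved_pair_in: "j \<in> {1..<d} \<Longrightarrow> x \<in> {-1..2} \<Longrightarrow> moved_pair j x \<in> point_pairs d"
  by (auto simp: point_pairs_def)

lemma moved_pt_rigid:
  "sqdist d (moved_pt 1 j x) (moved_pt 1 k y) = sqdist d (moved_pt (-1) j x) (moved_pt (-1) k y)"
  unfolding sqdist_def by (rule sum.cong) (auto simp: moved_pt_def power2_eq_square algebra_simps)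

text \<open>
  With \<open>A = s (s + 1) + x (x - 1)\<close>, the sign \<open>e\<close> enters through the square \<open>(A + e)\<^sup>2\<close> in coordinate
  \<open>0\<close> and, if the axes agree, through \<open>(2 s - e x)\<^sup>2\<close> in the coordinate of the axis.
\<close>
lemma sqdist_gain:
  assumes "j \<in> {1..<d}" "k \<in> {1..<d}"
  shows "sqdist d (fixed_pt j s) (moved_pt 1 k x) - sqdist d (fixed_pt j s) (moved_pt (-1) k x) =
         of_int (4 * (s * (s + 1) + x * (x - 1) - (if j = k then 2 * s * x else 0)))"
proof -
  have "sqdist d (fixed_pt j s) (moved_pt 1 k x) - sqdist d (fixed_pt j s) (moved_pt (-1) k x) =
    (\<Sum>i<d. (if i = 0 then of_int (4 * (s * (s + 1) + x * (x - 1))) else 0)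
          + (if i = j then if j = k then of_int (- 8 * s * x) else 0 else 0))"
    unfolding sqdist_def sum_subtractf[symmetric]
    by (rule sum.cong) (use assms in \<open>auto simp: fixed_pt_def moved_pt_def power2_eq_square algebra_simps\<close>)
  also have "\<dots> = of_int (4 * (s * (s + 1) + x * (x - 1))) + (if j = k then of_int (- 8 * s * x) else 0)"
    using assms by (simp add: sum.distrib)
  finally show ?thesis by auto
qed

lemma consecutive_product_nonneg: "0 \<le> n * (n + 1)" for n :: int
  by (cases "0 \<le> n") (auto intro: mult_nonpos_nonpos)

text \<open>
  The parabolas are chosen for this: on one axis the gain is \<open>n (n + 1)\<close> with \<open>n = s - x\<close>, and on two
  different axes it is a sum of two such products. The parameters have to be integers.
\<close>
lemma gain_nonneg: "0 \<le> s * (s + 1) + x * (x - 1) - (if j = k then 2 * s * x else 0)"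
  for s x :: int
proof (cases "j = k")
  case True
  have "0 \<le> (s - x) * ((s - x) + 1)" by (rule consecutive_product_nonneg)
  then show ?thesis using True by (simp add: algebra_simps)
next
  case False
  then show ?thesis
    using consecutive_product_nonneg[of s] consecutive_product_nonneg[of "x - 1"]
    by (simp add: mult.commute)
qed

lemma point_pairs_expanding:
  assumes "l \<in> point_pairs d" "m \<in> point_pairs d"
  shows "sqdist d (fst l) (fst m) \<le> sqdist d (snd l) (snd m)"
proof -
  have FM: "sqdist d (fst (fixed_pair j s)) (fst (moved_pair k x)) \<le>
            sqdist d (snd (fixed_pair j s)) (snd (moved_pair k x))"
    if "j \<in> {1..<d}" "k \<in> {1..<d}" for j s k x
  proof -
    have "0 \<le> (of_int (4 * (s * (s + 1) + x * (x - 1) - (if j = k then 2 * s * x else 0))) :: real)"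
      unfolding of_int_0_le_iff by (rule mult_nonneg_nonneg[OF _ gain_nonneg]) simp
    then show ?thesis
      using sqdist_gain[OF that, of s x] by (simp add: fixed_pair_def moved_pair_def)
  qed
  show ?thesis
    using assms(1)
  proof (cases rule: point_pairs_cases)
    case l: (fixed j s)
    show ?thesis using assms(2)
      by (cases rule: point_pairs_cases) (use l FM in \<open>auto simp: fixed_pair_def\<close>)
  next
    case l: (moved j x)
    show ?thesis using assms(2)
    proof (cases rule: point_pairs_cases)
      case (fixed k s)
      then show ?thesis using FM[of k j s x] l by (simp add: sqdist_commute)
    next
      case (moved k y)
      then show ?thesis using l by (simp add: moved_pair_def moved_pt_rigid)
    qed
  qed
qed

section \<open>One averaged distance forces all distances to be averaged\<close>

text \<open>
  Restricted to one axis, the function to be determined is quadratic in each parameter and vanishes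
  for \<open>x = s\<close> and \<open>x = s + 1\<close>, as the product \<open>(x - s) (x - s - 1)\<close> does; the parameter ranges contain
  just enough zeros to leave no other possibility. The factor is read off at \<open>s = 0\<close>, \<open>x = -1\<close>, where
  the product is \<open>2\<close>. \<open>A\<close> and \<open>B\<close> express being quadratic by third differences.
\<close>
lemma biquadratic_table:
  fixes h :: "int \<Rightarrow> int \<Rightarrow> real"
  assumes A: "\<And>s x. s \<in> {-2, -1} \<Longrightarrow> x \<in> {-1..2} \<Longrightarrow>
      h (s + 3) x - 3 * h (s + 2) x + 3 * h (s + 1) x - h s x = 0"
    and B: "\<And>s. s \<in> {-2..2} \<Longrightarrow> h s 2 - 3 * h s 1 + 3 * h s 0 - h s (-1) = 0"
    and Z: "\<And>s. s \<in> {-1..2} \<Longrightarrow> h s s = 0" "\<And>s. s \<in> {-2..1} \<Longrightarrow> h s (s + 1) = 0"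
    and sx: "s \<in> {-2..2}" "x \<in> {-1..2}"
  shows "h s x = h 0 (- 1) / 2 * of_int ((x - s) * (x - s - 1))"
proof -
  have s: "s = -2 \<or> s = -1 \<or> s = 0 \<or> s = 1 \<or> s = 2" and x: "x = -1 \<or> x = 0 \<or> x = 1 \<or> x = 2"
    using sx by auto
  note AA = A[of "-2" "-1"] A[of "-2" 0] A[of "-2" 1] A[of "-2" 2]
    A[of "-1" "-1"] A[of "-1" 0] A[of "-1" 1] A[of "-1" 2]
  note BB = B[of "-2"] B[of "-1"] B[of 0] B[of 1] B[of 2]
  note ZZ = Z(1)[of "-1"] Z(1)[of 0] Z(1)[of 1] Z(1)[of 2] Z(2)[of "-2"] Z(2)[of "-1"] Z(2)[of 0] Z(2)[of 1]
  show ?thesis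
    using s x AA BB ZZ by (elim disjE; simp; linarith)
qed

text \<open>
  Along each axis a biaffine function is a multiple of the gain, by the previous lemma. The factor is
  half a second difference in \<open>x\<close> at \<open>s = 0\<close>. The second differences of the points themselves do not
  depend on the axis (\<open>A2\<close>, \<open>B2\<close>), and neither does the point \<open>s = 0\<close>, so all axes have the same
  factor, and one further zero at \<open>w\<close> makes it \<open>0\<close>. For two different axes this leaves a multiple
  of \<open>s x\<close>, which is excluded by the zero at \<open>s = -1\<close>, \<open>x = 1\<close>.
\<close>
lemma biaffine_table_vanishes:
  fixes h :: "nat \<Rightarrow> int \<Rightarrow> nat \<Rightarrow> int \<Rightarrow> real" and J :: "nat set"
  assumes A: "\<And>j k s x. j \<in> J \<Longrightarrow> k \<in> J \<Longrightarrow> s \<in> {-2, -1} \<Longrightarrow> x \<in> {-1..2} \<Longrightarrow>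
      h j (s + 3) k x - 3 * h j (s + 2) k x + 3 * h j (s + 1) k x - h j s k x = 0"
    and B: "\<And>j k s. j \<in> J \<Longrightarrow> k \<in> J \<Longrightarrow> s \<in> {-2..2} \<Longrightarrow>
      h j s k 2 - 3 * h j s k 1 + 3 * h j s k 0 - h j s k (-1) = 0"
    and A2: "\<And>i j k x. i \<in> J \<Longrightarrow> j \<in> J \<Longrightarrow> k \<in> J \<Longrightarrow> x \<in> {-1..2} \<Longrightarrow>
      h i 1 k x + h i (-1) k x = h j 1 k x + h j (-1) k x"
    and B2: "\<And>i j k s. i \<in> J \<Longrightarrow> j \<in> J \<Longrightarrow> k \<in> J \<Longrightarrow> s \<in> {-2..2} \<Longrightarrow>
      h k s i 1 + h k s i (-1) = h k s j 1 + h k s j (-1)"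
    and A0: "\<And>i j k x. h i 0 k x = h j 0 k x"
    and B0: "\<And>i j k s. h k s i 0 = h k s j 0"
    and Z: "\<And>j s. j \<in> J \<Longrightarrow> s \<in> {-1..2} \<Longrightarrow> h j s j s = 0"
      "\<And>j s. j \<in> J \<Longrightarrow> s \<in> {-2..1} \<Longrightarrow> h j s j (s + 1) = 0"
      "\<And>j k. j \<in> J \<Longrightarrow> k \<in> J \<Longrightarrow> j \<noteq> k \<Longrightarrow> h j (-1) k 1 = 0"
    and norm: "w \<in> J" "h w 0 w (-1) = 0"
    and jk: "j \<in> J" "k \<in> J" "s \<in> {-2..2}" "x \<in> {-1..2}"
  shows "h j s k x = 0"
proof -
  have axis: "h i s i x = h i 0 i (- 1) / 2 * of_int ((x - s) * (x - s - 1))"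
    if "i \<in> J" "s \<in> {-2..2}" "x \<in> {-1..2}" for i s x
    by (rule biquadratic_table[of "\<lambda>s x. h i s i x"]) (use that A B Z in auto)
  have same: "h i s i x = 0" if i: "i \<in> J" and "s \<in> {-2..2}" "x \<in> {-1..2}" for i s x
  proof -
    have "h i 0 i (-1) = h w 0 w (-1)"
      using B2[of i w i 0] A0[of i w 1 w] A0[of i w "-1" w] Z(2)[of i 0] Z(2)[of w 0] norm(1) i
      by simp
    then show ?thesis using axis[OF that] norm(2) by simp
  qed
  show ?thesis
  proof (cases "j = k")
    case True
    then show ?thesis using same jk by simp
  next
    case False
    \<comment> \<open>Both parameters are reduced to \<open>-1..1\<close>, where evenness and oddness decide; third
      differences extend the vanishing to the full ranges.\<close>
    have h0: "h j 0 k y = 0" if "y \<in> {-1..2}" for y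
      using A0[of j k y k] same[of k 0 y] that jk by simp
    have h0': "h j r k 0 = 0" if "r \<in> {-2..2}" for r
      using B0[of j r k j] same[of j r 0] that jk by simp
    have antiA: "h j 1 k y = - h j (-1) k y" if "y \<in> {-1..2}" for y
      using A2[of j k k y] same[of k _ y] that jk by simp
    have antiB: "h j r k 1 = - h j r k (-1)" if "r \<in> {-2..2}" for r
      using B2[of j k j r] same[of j r] that jk by simp
    have corner: "h j r k y = 0" if "r \<in> {-1..1}" "y \<in> {-1..1}" for r y
    proof -
      have "r = -1 \<or> r = 0 \<or> r = 1" "y = -1 \<or> y = 0 \<or> y = 1" using that by auto
      then show ?thesis
        using h0[of y] h0'[of r] antiA[of y] antiB[of "-1"] Z(3)[OF jk(1,2) False] by auto
    qed
    have right: "h j r k y = 0" if "r \<in> {-1..1}" "y \<in> {-1..2}" for r y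
      using corner[of r y] corner[of r 1] corner[of r 0] corner[of r "-1"] B[OF jk(1,2), of r] that
      by (cases "y = 2") auto
    have "s = -2 \<or> s = 2 \<or> s \<in> {-1..1}" using jk(3) by auto
    then show ?thesis
      using right[of s x] right[of "-1" x] right[of 0 x] right[of 1 x]
        A[OF jk(1,2), of "-2" x] A[OF jk(1,2), of "-1" x] jk(4) by auto
  qed
qed


text \<open>
  By rigidity the combination of the current squared distances equals the one at either end of the
  motion, hence also their average. The dependencies between points of the parabolas that are
  needed below all involve four points.
\<close>
lemma four_point_dependency:
  assumes c: "c1 + c2 + c3 + c4 = 0"
    and P: "\<And>k. c1 * fst l1 k + c2 * fst l2 k + c3 * fst l3 k + c4 * fst l4 k = 0"
    and Q: "\<And>k. c1 * snd l1 k + c2 * snd l2 k + c3 * snd l3 k + c4 * snd l4 k = 0"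
    and rigidP: "\<And>l m. l \<in> {l1, l2, l3, l4} \<Longrightarrow> m \<in> {l1, l2, l3, l4} \<Longrightarrow>
        sqdist f (X l) (X m) = sqdist d (fst l) (fst m)"
    and rigidQ: "\<And>l m. l \<in> {l1, l2, l3, l4} \<Longrightarrow> m \<in> {l1, l2, l3, l4} \<Longrightarrow>
        sqdist f (X l) (X m) = sqdist d (snd l) (snd m)"
    and dev: "\<And>l. dev l = sqdist f (X l) y - (sqdist d (fst l) u + sqdist d (snd l) v) / 2"
  shows "c1 * dev l1 + c2 * dev l2 + c3 * dev l3 + c4 * dev l4 = 0"
proof -
  define c where "c = (!) [c1, c2, c3, c4]"
  define l where "l = (!) [l1, l2, l3, l4]"
  have sum4: "(\<Sum>i<4. g i) = g 0 + g 1 + g 2 + g 3" for g :: "nat \<Rightarrow> real"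
    by (simp add: eval_nat_numeral)
  have l: "l i \<in> {l1, l2, l3, l4}" if "i < 4" for i :: nat
    using that by (auto simp: l_def less_Suc_eq eval_nat_numeral)
  have "(\<Sum>i<4. c i * sqdist f (X (l i)) y) = (\<Sum>i<4. c i * sqdist d (fst (l i)) u)"
    by (rule rigid_dependency_sqdist) (use c P l rigidP in \<open>simp_all add: sum4, simp_all add: c_def l_def eval_nat_numeral\<close>)
  moreover have "(\<Sum>i<4. c i * sqdist f (X (l i)) y) = (\<Sum>i<4. c i * sqdist d (snd (l i)) v)"
    by (rule rigid_dependency_sqdist) (use c Q l rigidQ in \<open>simp_all add: sum4, simp_all add: c_def l_def eval_nat_numeral\<close>)
  ultimately show ?thesis
    by (simp add: sum4 dev c_def l_def eval_nat_numeral field_simps)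
qed


text \<open>The coordinates are quadratic polynomials of the parameter.\<close>
lemma fixed_pair_third_difference:
  "(1::real) * fst (fixed_pair j (s + 3)) k + (- 3) * fst (fixed_pair j (s + 2)) k
   + 3 * fst (fixed_pair j (s + 1)) k + (- 1) * fst (fixed_pair j s) k = 0"
  "(1::real) * snd (fixed_pair j (s + 3)) k + (- 3) * snd (fixed_pair j (s + 2)) k
   + 3 * snd (fixed_pair j (s + 1)) k + (- 1) * snd (fixed_pair j s) k = 0"
  by (simp_all add: fixed_pair_def fixed_pt_def algebra_simps)

lemma moved_pair_third_difference:
  "(1::real) * fst (moved_pair j 2) k + (- 3) * fst (moved_pair j 1) k
   + 3 * fst (moved_pair j 0) k + (- 1) * fst (moved_pair j (- 1)) k = 0"
  "(1::real) * snd (moved_pair j 2) k + (- 3) * snd (moved_pair j 1) k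
   + 3 * snd (moved_pair j 0) k + (- 1) * snd (moved_pair j (- 1)) k = 0"
  by (simp_all add: moved_pair_def moved_pt_def)

text \<open>
  On every axis, the midpoint of the points with parameters \<open>1\<close> and \<open>-1\<close> is the same point of the
  line of coordinate \<open>0\<close>.
\<close>
lemma fixed_pair_second_difference:
  assumes "0 < i" "0 < j"
  shows
  "(1::real) * fst (fixed_pair i 1) k + 1 * fst (fixed_pair i (- 1)) k
   + (- 1) * fst (fixed_pair j 1) k + (- 1) * fst (fixed_pair j (- 1)) k = 0"
  "(1::real) * snd (fixed_pair i 1) k + 1 * snd (fixed_pair i (- 1)) k
   + (- 1) * snd (fixed_pair j 1) k + (- 1) * snd (fixed_pair j (- 1)) k = 0"
  using assms by (auto simp: fixed_pair_def fixed_pt_def)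

lemma moved_pair_second_difference:
  assumes "0 < i" "0 < j"
  shows
  "(1::real) * fst (moved_pair i 1) k + 1 * fst (moved_pair i (- 1)) k
   + (- 1) * fst (moved_pair j 1) k + (- 1) * fst (moved_pair j (- 1)) k = 0"
  "(1::real) * snd (moved_pair i 1) k + 1 * snd (moved_pair i (- 1)) k
   + (- 1) * snd (moved_pair j 1) k + (- 1) * snd (moved_pair j (- 1)) k = 0"
  using assms by (auto simp: moved_pair_def moved_pt_def)

text \<open>
  The deviation from the average vanishes on pairs at constant distance. This covers pairs within one
  body and the zeros of the gain; the affine dependencies within the two bodies do the rest.
\<close>
lemma all_distances_averaged:
  assumes d: "2 \<le> d"
    and rigid: "\<And>l m. l \<in> point_pairs d \<Longrightarrow> m \<in> point_pairs d \<Longrightarrow>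
        sqdist d (fst l) (fst m) = sqdist d (snd l) (snd m) \<Longrightarrow>
        sqdist f (X l) (X m) = sqdist d (fst l) (fst m)"
    and avg: "sqdist f (X (fixed_pair 1 0)) (X (moved_pair 1 (- 1))) =
        (sqdist d (fst (fixed_pair 1 0)) (fst (moved_pair 1 (- 1))) +
         sqdist d (snd (fixed_pair 1 0)) (snd (moved_pair 1 (- 1)))) / 2"
    and lm: "l \<in> point_pairs d" "m \<in> point_pairs d"
  shows "sqdist f (X l) (X m) = (sqdist d (fst l) (fst m) + sqdist d (snd l) (snd m)) / 2"
proof -
  define dev where "dev l m = sqdist f (X l) (X m) -
      (sqdist d (fst l) (fst m) + sqdist d (snd l) (snd m)) / 2" for l m
  have dev_commute: "dev l m = dev m l" for l m
    by (simp add: dev_def sqdist_commute)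
  have rigid_dev: "dev l m = 0"
    if "l \<in> point_pairs d" "m \<in> point_pairs d"
      "sqdist d (fst l) (fst m) = sqdist d (snd l) (snd m)" for l m
    using rigid[OF that] that(3) by (simp add: dev_def)
  have FF: "sqdist d (fst (fixed_pair j s)) (fst (fixed_pair k r)) =
            sqdist d (snd (fixed_pair j s)) (snd (fixed_pair k r))" for j s k r
    by (simp add: fixed_pair_def)
  have MM: "sqdist d (fst (moved_pair j x)) (fst (moved_pair k y)) =
            sqdist d (snd (moved_pair j x)) (snd (moved_pair k y))" for j x k y
    by (simp add: moved_pair_def moved_pt_rigid)
  have tight: "dev (fixed_pair j s) (moved_pair k x) = 0"
    if "j \<in> {1..<d}" "k \<in> {1..<d}" "s \<in> {-2..2}" "x \<in> {-1..2}"
      "s * (s + 1) + x * (x - 1) - (if j = k then 2 * s * x else 0) = 0" for j k s x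
    by (rule rigid_dev[OF fixed_pair_in moved_pair_in])
      (use that sqdist_gain[of j d k s x] in \<open>simp_all add: fixed_pair_def moved_pair_def\<close>)
  have fixed_dep: "c1 * dev (fixed_pair j1 s1) m + c2 * dev (fixed_pair j2 s2) m
      + c3 * dev (fixed_pair j3 s3) m + c4 * dev (fixed_pair j4 s4) m = 0"
    if "c1 + c2 + c3 + c4 = 0"
      "{j1, j2, j3, j4} \<subseteq> {1..<d}" "{s1, s2, s3, s4} \<subseteq> {-2..2}"
      "\<And>k. c1 * fst (fixed_pair j1 s1) k + c2 * fst (fixed_pair j2 s2) k
         + c3 * fst (fixed_pair j3 s3) k + c4 * fst (fixed_pair j4 s4) k = 0"
    for c1 c2 c3 c4 j1 j2 j3 j4 s1 s2 s3 s4 m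
  proof -
    let ?S = "{fixed_pair j1 s1, fixed_pair j2 s2, fixed_pair j3 s3, fixed_pair j4 s4}"
    have S: "sqdist f (X l) (X m) = sqdist d (fst l) (fst m) \<and>
             sqdist d (fst l) (fst m) = sqdist d (snd l) (snd m)" if "l \<in> ?S" "m \<in> ?S" for l m
    proof -
      have "l \<in> point_pairs d" "m \<in> point_pairs d"
        using that \<open>{j1, j2, j3, j4} \<subseteq> {1..<d}\<close> \<open>{s1, s2, s3, s4} \<subseteq> {-2..2}\<close>
        by (auto intro!: fixed_pair_in)
      moreover have "sqdist d (fst l) (fst m) = sqdist d (snd l) (snd m)"
        using that FF by auto
      ultimately show ?thesis using rigid by blast
    qed
    show ?thesis
      by (rule four_point_dependency[where f = f and X = X and y = "X m"])
        (use that(1,4) S in \<open>simp_all add: dev_def fixed_pair_def\<close>)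
  qed
  have moved_dep: "c1 * dev l (moved_pair j1 x1) + c2 * dev l (moved_pair j2 x2)
      + c3 * dev l (moved_pair j3 x3) + c4 * dev l (moved_pair j4 x4) = 0"
    if "c1 + c2 + c3 + c4 = 0"
      "{j1, j2, j3, j4} \<subseteq> {1..<d}" "{x1, x2, x3, x4} \<subseteq> {-1..2}"
      "\<And>k. c1 * fst (moved_pair j1 x1) k + c2 * fst (moved_pair j2 x2) k
         + c3 * fst (moved_pair j3 x3) k + c4 * fst (moved_pair j4 x4) k = 0"
      "\<And>k. c1 * snd (moved_pair j1 x1) k + c2 * snd (moved_pair j2 x2) k
         + c3 * snd (moved_pair j3 x3) k + c4 * snd (moved_pair j4 x4) k = 0"
    for c1 c2 c3 c4 j1 j2 j3 j4 x1 x2 x3 x4 l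
  proof -
    let ?S = "{moved_pair j1 x1, moved_pair j2 x2, moved_pair j3 x3, moved_pair j4 x4}"
    have S: "sqdist f (X l) (X m) = sqdist d (fst l) (fst m) \<and>
             sqdist d (fst l) (fst m) = sqdist d (snd l) (snd m)" if "l \<in> ?S" "m \<in> ?S" for l m
    proof -
      have "l \<in> point_pairs d" "m \<in> point_pairs d"
        using that \<open>{j1, j2, j3, j4} \<subseteq> {1..<d}\<close> \<open>{x1, x2, x3, x4} \<subseteq> {-1..2}\<close>
        by (auto intro!: moved_pair_in)
      moreover have "sqdist d (fst l) (fst m) = sqdist d (snd l) (snd m)"
        using that MM by auto
      ultimately show ?thesis using rigid by blast
    qed
    have SP: "sqdist f (X l) (X m) = sqdist d (fst l) (fst m)"
     and SQ: "sqdist f (X l) (X m) = sqdist d (snd l) (snd m)" if "l \<in> ?S" "m \<in> ?S" for l m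
      using S[OF that] by simp_all
    have "c1 * dev (moved_pair j1 x1) l + c2 * dev (moved_pair j2 x2) l
      + c3 * dev (moved_pair j3 x3) l + c4 * dev (moved_pair j4 x4) l = 0"
      by (rule four_point_dependency[where f = f and X = X and y = "X l", OF that(1,4,5) SP SQ])
        (simp_all add: dev_def)
    then show ?thesis by (simp add: dev_commute)
  qed
  have FM: "dev (fixed_pair j s) (moved_pair k x) = 0"
    if "j \<in> {1..<d}" "k \<in> {1..<d}" "s \<in> {-2..2}" "x \<in> {-1..2}" for j k s x
  proof (rule biaffine_table_vanishes[where J = "{1..<d}" and w = 1 and
        h = "\<lambda>j s k x. dev (fixed_pair j s) (moved_pair k x)"])
    fix j k :: nat and s x :: int
    assume "j \<in> {1..<d}" "k \<in> {1..<d}" "s \<in> {-2, -1}" "x \<in> {-1..2}"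
    then show "dev (fixed_pair j (s + 3)) (moved_pair k x) - 3 * dev (fixed_pair j (s + 2)) (moved_pair k x)
        + 3 * dev (fixed_pair j (s + 1)) (moved_pair k x) - dev (fixed_pair j s) (moved_pair k x) = 0"
      using fixed_dep[OF _ _ _ fixed_pair_third_difference(1)[of j s], of "moved_pair k x"] by auto
  next
    fix j k :: nat and s :: int
    assume "j \<in> {1..<d}" "k \<in> {1..<d}" "s \<in> {-2..2}"
    then show "dev (fixed_pair j s) (moved_pair k 2) - 3 * dev (fixed_pair j s) (moved_pair k 1)
        + 3 * dev (fixed_pair j s) (moved_pair k 0) - dev (fixed_pair j s) (moved_pair k (- 1)) = 0"
      using moved_dep[OF _ _ _ moved_pair_third_difference[of k], of "fixed_pair j s"] by auto
  next
    fix i j k :: nat and x :: int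
    assume "i \<in> {1..<d}" "j \<in> {1..<d}" "k \<in> {1..<d}" "x \<in> {-1..2}"
    then show "dev (fixed_pair i 1) (moved_pair k x) + dev (fixed_pair i (- 1)) (moved_pair k x) =
        dev (fixed_pair j 1) (moved_pair k x) + dev (fixed_pair j (- 1)) (moved_pair k x)"
      using fixed_dep[OF _ _ _ fixed_pair_second_difference(1)[of i j], of "moved_pair k x"] by auto
  next
    fix i j k :: nat and s :: int
    assume "i \<in> {1..<d}" "j \<in> {1..<d}" "k \<in> {1..<d}" "s \<in> {-2..2}"
    then show "dev (fixed_pair k s) (moved_pair i 1) + dev (fixed_pair k s) (moved_pair i (- 1)) =
        dev (fixed_pair k s) (moved_pair j 1) + dev (fixed_pair k s) (moved_pair j (- 1))"
      using moved_dep[OF _ _ _ moved_pair_second_difference[of i j], of "fixed_pair k s"] by auto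
  next
    show "dev (fixed_pair i 0) (moved_pair k x) = dev (fixed_pair j 0) (moved_pair k x)" for i j k x
      by (simp only: fixed_pair_0[of i j])
    show "dev (fixed_pair k s) (moved_pair i 0) = dev (fixed_pair k s) (moved_pair j 0)" for i j k s
      by (simp only: moved_pair_0[of i j])
  next
    show "dev (fixed_pair 1 0) (moved_pair 1 (- 1)) = 0"
      using avg by (simp add: dev_def)
  qed (use that d in \<open>auto intro!: tight simp: algebra_simps\<close>)
  have "dev l m = 0"
    using lm(1)
  proof (cases rule: point_pairs_cases)
    case l: (fixed j s)
    show ?thesis using lm(2)
      by (cases rule: point_pairs_cases) (use l lm FF rigid_dev FM in auto)
  next
    case l: (moved j x)
    show ?thesis using lm(2)
      by (cases rule: point_pairs_cases) (use l lm MM rigid_dev FM dev_commute[of l m] in auto)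
  qed
  then show ?thesis by (simp add: dev_def)
qed

section \<open>The averaged configuration spans dimension 2d\<close>

text \<open>
  In fewer than \<open>2d\<close> dimensions any \<open>2d + 1\<close> points satisfy a nontrivial affine dependency. Since the
  squared distances are averages, the squared length of a weighted sum with weights of sum zero is
  the average of the squared lengths at the two ends, so the dependency holds at both ends. The
  proof selects \<open>2d + 1\<close> points that have no common dependency.
\<close>
lemma averaged_distances_dimension:
  assumes d: "2 \<le> d"
    and avg: "\<And>l m. l \<in> point_pairs d \<Longrightarrow> m \<in> point_pairs d \<Longrightarrow>
        sqdist f (X l) (X m) = (sqdist d (fst l) (fst m) + sqdist d (snd l) (snd m)) / 2"
  shows "2 * d \<le> f"
proof (rule ccontr)
  assume "\<not> 2 * d \<le> f"
  then have f: "f < 2 * d" by simp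
  \<comment> \<open>\<open>d + 1\<close> fixed points in general position, and \<open>d\<close> moved ones whose displacements are
    linearly independent. The difference of the two ends sees only the latter, so their
    coefficients vanish first; the coordinates then single out the others one by one.\<close>
  define u where "u i = (if i = 0 then fixed_pair 1 1 else if i < d then fixed_pair i (- 1)
      else if i = d then moved_pair 1 0 else if i < 2 * d then moved_pair (i - d) 1
      else fixed_pair 1 0)" for i
  have u_in: "u i \<in> point_pairs d" if "i \<le> 2 * d" for i
    using d that unfolding u_def by (auto intro!: fixed_pair_in moved_pair_in)
  \<comment> \<open>Equation \<open>f\<close> says that the weights have sum zero, the others that the weighted sum is zero.\<close>
  obtain c where c: "\<exists>i\<in>{..2 * d}. c i \<noteq> 0"
    "\<forall>k<Suc f. (\<Sum>i\<le>2 * d. c i * (if k < f then X (u i) k else 1)) = 0"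
    using ex_null_combination[of "{..2 * d}" "Suc f" "\<lambda>i k. if k < f then X (u i) k else 1"] f
    by auto
  have c0: "(\<Sum>i\<le>2 * d. c i) = 0"
    using c(2)[rule_format, of f] by simp
  have cX: "(\<Sum>i\<le>2 * d. c i * X (u i) k) = 0" if "k < f" for k
    using c(2)[rule_format, of k] that by simp
  let ?P = "\<lambda>k. \<Sum>i\<le>2 * d. c i * fst (u i) k" and ?Q = "\<lambda>k. \<Sum>i\<le>2 * d. c i * snd (u i) k"
  have "0 = (\<Sum>i\<le>2 * d. \<Sum>j\<le>2 * d. c i * c j * sqdist f (X (u i)) (X (u j)))"
    by (simp add: sum_weighted_sqdist[OF c0] cX)
  also have "\<dots> = (\<Sum>i\<le>2 * d. \<Sum>j\<le>2 * d. c i * c j * sqdist d (fst (u i)) (fst (u j)) / 2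
                                  + c i * c j * sqdist d (snd (u i)) (snd (u j)) / 2)"
    by (intro sum.cong refl) (simp add: avg u_in field_simps)
  also have "\<dots> = - (\<Sum>k<d. (?P k)\<^sup>2) - (\<Sum>k<d. (?Q k)\<^sup>2)"
    by (simp add: sum.distrib sum_divide_distrib[symmetric] sum_weighted_sqdist[OF c0])
  finally have "(\<Sum>k<d. (?P k)\<^sup>2) + (\<Sum>k<d. (?Q k)\<^sup>2) = 0" by simp
  then have "(\<Sum>k<d. (?P k)\<^sup>2) = 0 \<and> (\<Sum>k<d. (?Q k)\<^sup>2) = 0"
    by (simp add: add_nonneg_eq_0_iff sum_nonneg)
  then have P: "?P k = 0" and Q: "?Q k = 0" if "k < d" for k
    using that by (simp_all add: sum_nonneg_eq_0_iff)
  have diff: "(\<Sum>i\<le>2 * d. c i * (snd (u i) k - fst (u i) k)) = 0" if "k < d" for k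
    using P[OF that] Q[OF that] by (simp add: right_diff_distrib sum_subtractf)
  note u_simps = u_def fixed_pair_def fixed_pt_def moved_pair_def moved_pt_def
  have eps: "c (d + k) = 0" if k: "0 < k" "k < d" for k
  proof -
    have "(\<Sum>i\<le>2 * d. c i * (snd (u i) k - fst (u i) k)) = (\<Sum>i\<le>2 * d. if i = d + k then 2 * c i else 0)"
      using k by (intro sum.cong refl) (auto simp: u_simps)
    then show ?thesis using diff[OF k(2)] k by simp
  qed
  have eps': "c i = 0" if "d < i" "i < 2 * d" for i
    using eps[of "i - d"] that by simp
  have "(\<Sum>i\<le>2 * d. c i * (snd (u i) 0 - fst (u i) 0)) = (\<Sum>i\<le>2 * d. if i = d then 2 * c i else 0)"
    using d eps' by (intro sum.cong refl) (auto simp: u_simps)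
  then have delta: "c d = 0" using diff[of 0] d by simp
  have "?P 0 = (\<Sum>i\<le>2 * d. if i = 0 then - 2 * c i else 0)"
    using d eps' delta by (intro sum.cong refl) (auto simp: u_simps)
  then have gamma: "c 0 = 0" using P[of 0] d by simp
  have beta: "c k = 0" if k: "0 < k" "k < d" for k
  proof -
    have "?P k = (\<Sum>i\<le>2 * d. if i = k then - 2 * c i else 0)"
      using k eps' delta gamma by (intro sum.cong refl) (auto simp: u_simps)
    then show ?thesis using P[OF k(2)] k by simp
  qed
  have most: "c i = 0" if "i < 2 * d" for i
    using that gamma beta[of i] delta eps'[of i] by (metis linorder_neqE_nat not_gr_zero)
  have "(\<Sum>i\<le>2 * d. c i) = c (2 * d)"
    using most by (subst sum.remove[of _ "2 * d"]) (auto intro!: sum.neutral)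
  then have "c i = 0" if "i \<le> 2 * d" for i
    using c0 most that by (cases "i = 2 * d") auto
  then show False using c(1) by auto
qed

theorem theorem1p4:
  fixes d N :: nat
  assumes "d \<ge> 2" and "N = (d + 1)^2"
  shows "\<exists>p q. configuration d N p \<and> configuration d N q \<and> is_expansion d N p q \<and>
           (\<forall>f. d \<le> f \<and> f < 2 * d \<longrightarrow> \<not> continuous_expansion d f N p q)"
proof -
  let ?L = "point_pairs d"
  let ?a = "fixed_pair 1 0" and ?b = "moved_pair 1 (- 1)"
  have ab: "?a \<in> ?L" "?b \<in> ?L"
    using assms(1) by (auto intro!: fixed_pair_in moved_pair_in)
  have fin: "finite ?L" by (simp add: point_pairs_def)
  have dim: "fst l \<in> topspace (Euclidean_space d) \<and> snd l \<in> topspace (Euclidean_space d)"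
    if "l \<in> ?L" for l
    using that
    by (cases rule: point_pairs_cases)
      (auto simp: fixed_pair_def moved_pair_def fixed_pt_def moved_pt_def Euclidean_space_def)
  obtain p q where pq: "configuration d N p" "configuration d N q" "is_expansion d N p q"
    and paths: "\<And>f. d \<le> f \<Longrightarrow> continuous_expansion d f N p q \<Longrightarrow> \<exists>G. expands_along d f ?L G"
    using pairs_as_configurations[of ?L N d] fin ab(1) card_point_pairs_le[OF assms(1)] assms(2)
      dim point_pairs_expanding by blast
  have "2 * d \<le> f" if f: "d \<le> f" "continuous_expansion d f N p q" for f
  proof -
    obtain G where G: "expands_along d f ?L G"
      using paths[OF f] by blast
    then have cont: "\<And>l k. l \<in> ?L \<Longrightarrow> continuous_on {0..1} (\<lambda>t. G t l k)"
      and G0: "\<And>l m. l \<in> ?L \<Longrightarrow> m \<in> ?L \<Longrightarrow> sqdist f (G 0 l) (G 0 m) = sqdist d (fst l) (fst m)"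
      and G1: "\<And>l m. l \<in> ?L \<Longrightarrow> m \<in> ?L \<Longrightarrow> sqdist f (G 1 l) (G 1 m) = sqdist d (snd l) (snd m)"
      and mono: "\<And>l m s t. l \<in> ?L \<Longrightarrow> m \<in> ?L \<Longrightarrow> 0 \<le> s \<Longrightarrow> s \<le> t \<Longrightarrow> t \<le> 1 \<Longrightarrow>
               sqdist f (G s l) (G s m) \<le> sqdist f (G t l) (G t m)"
      by (simp_all add: expands_along_def)
    \<comment> \<open>The gain of this pair is \<open>8\<close>; any pair of positive gain on one axis would do.\<close>
    have "continuous_on {0..1} (\<lambda>t. sqdist f (G t ?a) (G t ?b))"
      unfolding sqdist_def by (intro continuous_intros cont ab)
    then obtain t where t: "0 \<le> t" "t \<le> 1"
      "sqdist f (G t ?a) (G t ?b) = (sqdist d (fst ?a) (fst ?b) + sqdist d (snd ?a) (snd ?b)) / 2"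
      using IVT'[of "\<lambda>t. sqdist f (G t ?a) (G t ?b)" 0
          "(sqdist d (fst ?a) (fst ?b) + sqdist d (snd ?a) (snd ?b)) / 2" 1]
        point_pairs_expanding[OF ab] G0[OF ab] G1[OF ab] by (auto simp del: One_nat_def)
    show ?thesis
    proof (rule averaged_distances_dimension[OF assms(1) all_distances_averaged[OF assms(1) _ t(3)]])
      fix l m assume "l \<in> ?L" "m \<in> ?L" "sqdist d (fst l) (fst m) = sqdist d (snd l) (snd m)"
      then show "sqdist f (G t l) (G t m) = sqdist d (fst l) (fst m)"
        using mono[of l m 0 t] mono[of l m t 1] t G0[of l m] G1[of l m] by simp
    qed
  qed
  then show ?thesis using pq by (meson not_le)
qed

end
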